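(* Suppose $\boldsymbol\xi\sim P$ satisfies density-level regular variation with index $s>0$. Let $f_{\mathsf{gen}}^{(t)}$ be the radial–angular density $$f_{\mathsf{gen}}^{(t)}(r,\boldsymbol\phi)=f_{R,\boldsymbol\Phi}(r,\boldsymbol\phi)\mathbf 1(r<t)+p_t\,s\,t^s r^{-(s+1)}\varphi^{(t)}(\boldsymbol\phi)\mathbf 1(r>t).$$ Then $$\sup_{r>t,\ \boldsymbol\phi\in\Theta_{\mathcal E}}\left|\frac{f_{R,\boldsymbol\Phi}(r,\boldsymbol\phi)}{f_{\mathsf{gen}}^{(t)}(r,\boldsymbol\phi)}-1\right|\to0\qquad\text{as }t\to\infty.$$ Moreover, let $t(u)\to\infty$ satisfy $t(u)=o(u)$ as $u\to\infty$, and suppose that $\boldsymbol\xi_u^{\rm gen}$ has radial–angular density $f_{\mathsf{gen}}^{(t(u))}$. Then $\{\boldsymbol\xi_u^{\rm gen}\}_{u>0}\in\mathcal T(P)$. In particular, this holds for $t(u)=u^\theta$ with $\theta\in(0,1)$.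
   Context: Setting. $\|\cdot\|$ is the Euclidean norm on $\mathbb R^d$; $\mathcal E\subset\mathbb R^d$ is a closed cone; $\Theta_{\mathcal E}=\{\boldsymbol z\in\mathcal E:\|\boldsymbol z\|=1\}$; $B_r=\{\boldsymbol z:\|\boldsymbol z\|\le r\}$; $d\boldsymbol\phi$ is surface measure on $\Theta_{\mathcal E}$, so $d\boldsymbol z=r^{d-1}\,dr\,d\boldsymbol\phi$ for $\boldsymbol z=r\boldsymbol\phi$. $\boldsymbol\xi\sim P$ is a random vector with density $f_{\boldsymbol\xi}$ supported on $\mathcal E$. Density-level regular variation: $f_{\boldsymbol\xi}$ is continuous on $B_{r_0}^c\cap\mathcal E$ for some $r_0>0$, and there are $s>0$ and $\varphi^\star:\mathcal E\setminus\{\boldsymbol 0\}\to(0,\infty)$ with $t^{s+d}f_{\boldsymbol\xi}(t\boldsymbol z)\to\varphi^\star(\boldsymbol z)$ as $t\to\infty$, uniformly over compact subsets of $\mathcal E\setminus\{\boldsymbol 0\}$. Polar notation: $R=\|\boldsymbol\xi\|$, $\boldsymbol\Phi=\boldsymbol\xi/\|\boldsymbol\xi\|$; $f_{R,\boldsymbol\Phi}(r,\boldsymbol\phi)=r^{d-1}f_{\boldsymbol\xi}(r\boldsymbol\phi)$ is their joint density w.r.t. $dr\,d\boldsymbol\phi$; $p_t=\mathbb P(R>t)$; $\varphi^{(t)}(\boldsymbol\phi)=p_t^{-1}\int_t^\infty f_{R,\boldsymbol\Phi}(r,\boldsymbol\phi)\,dr$ is the conditional density of $\boldsymbol\Phi$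 given $\{R>t\}$. A random vector $\boldsymbol\eta$ in $\mathcal E$ has radial–angular density $g$ if $(\|\boldsymbol\eta\|,\boldsymbol\eta/\|\boldsymbol\eta\|)$ has density $g$ w.r.t. $dr\,d\boldsymbol\phi$. $\boldsymbol M_0$-convergence: $\boldsymbol M_0$ is the class of nonnegative Borel measures on $\mathcal E\setminus\{\boldsymbol0\}$ that are finite on $\{\|\boldsymbol z\|>r\}$ for every $r>0$. $\mu_n\to\mu$ in $\boldsymbol M_0$ if $\mu_n(B)\to\mu(B)$ for every Borel $B$ with $\mu(\partial B)=0$ and $\boldsymbol0\notin\operatorname{cl}(B)$ (and similarly for a continuous parameter $u\to\infty$). Limiting tail measure: $d\nu^\star(r,\boldsymbol\phi)=r^{-(s+1)}\varphi^\star(\boldsymbol\phi)\,dr\,d\boldsymbol\phi$ on $\mathcal E\setminus\{\boldsymbol0\}$ in polar coordinates. Tail preservation: a family of random vectors $\{\boldsymbol\xi_u\}_{u>0}$ in $\mathcal E$ is in $\mathcal T(P)$ if $u^s\mathbb P(u^{-1}\boldsymbol\xi_u\in\cdot)\to\nu^\star$ in $\boldsymbol M_0$ as $u\to\infty$. *)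

theory Defs
  imports "HOL-Probability.Probability" "HOL-Library.Landau_Symbols"
begin

text \<open>
  The surface measure on the unit sphere, as a Borel measure on the whole space that is
  concentrated on the sphere: a Borel set \<open>A\<close> of directions receives \<open>d\<close> times
  the Lebesgue measure of the part of the unit ball lying over \<open>A\<close>. This is the
  normalisation for which \<open>dz = r ^ (d - 1) dr d\<phi>\<close>; for \<open>d = 1\<close> it is the
  counting measure on \<open>{-1, 1}\<close>.
\<close>

definition sphere_measure :: "'a::euclidean_space measure" where
  "sphere_measure =
     distr (density lborel (\<lambda>z. ennreal (real DIM('a)) * indicator (cball 0 1) z)) borel
       (\<lambda>z. z /\<^sub>R norm z)"

definition cone_sphere :: "'a::euclidean_space set \<Rightarrow> 'a set" where
  "cone_sphere E = {z \<in> E. norm z = 1}"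

text \<open>
  The reference measure \<open>dr d\<phi>\<close> on \<open>(0, \<infinity>) \<times> cone_sphere E\<close>. The restrictions are
  expressed by indicator densities, so that \<open>(norm z, z /\<^sub>R norm z)\<close> is measurable
  into it also for random vectors that take the value \<open>0\<close> on a null set.
\<close>

definition polar_measure :: "'a::euclidean_space set \<Rightarrow> (real \<times> 'a) measure" where
  "polar_measure E =
     density lborel (indicator {0<..}) \<Otimes>\<^sub>M density sphere_measure (indicator (cone_sphere E))"

definition density_regularly_varying ::
    "'a::euclidean_space set \<Rightarrow> ('a \<Rightarrow> real) \<Rightarrow> real \<Rightarrow> ('a \<Rightarrow> real) \<Rightarrow> bool" where
  "density_regularly_varying E f s \<phi>s \<longleftrightarrow>
     (\<exists>r0>0. continuous_on (E - cball 0 r0) f) \<and>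
     s > 0 \<and>
     (\<forall>z\<in>E - {0}. \<phi>s z > 0) \<and>
     (\<forall>K. compact K \<and> K \<subseteq> E - {0} \<longrightarrow>
        uniform_limit K (\<lambda>t z. t powr (s + real DIM('a)) * f (t *\<^sub>R z)) \<phi>s at_top)"

definition polar_density :: "('a::euclidean_space \<Rightarrow> real) \<Rightarrow> real \<Rightarrow> 'a \<Rightarrow> real" where
  "polar_density f r \<phi> = r ^ (DIM('a) - 1) * f (r *\<^sub>R \<phi>)"

definition radial_tail :: "'b measure \<Rightarrow> ('b \<Rightarrow> 'a::euclidean_space) \<Rightarrow> real \<Rightarrow> real" where
  "radial_tail M \<xi> t = measure M {\<omega> \<in> space M. norm (\<xi> \<omega>) > t}"

definition angular_density ::
    "'b measure \<Rightarrow> ('b \<Rightarrow> 'a::euclidean_space) \<Rightarrow> ('a \<Rightarrow> real) \<Rightarrow> real \<Rightarrow> 'a \<Rightarrow> real" where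
  "angular_density M \<xi> f t \<phi> =
     inverse (radial_tail M \<xi> t) * (LINT r:{t<..}|lborel. polar_density f r \<phi>)"

definition gen_density ::
    "'b measure \<Rightarrow> ('b \<Rightarrow> 'a::euclidean_space) \<Rightarrow> ('a \<Rightarrow> real) \<Rightarrow> real \<Rightarrow> real \<Rightarrow> real \<Rightarrow> 'a \<Rightarrow> real" where
  "gen_density M \<xi> f s t r \<phi> =
     polar_density f r \<phi> * indicator {..<t} r +
     radial_tail M \<xi> t * s * t powr s * r powr (-(s + 1)) * angular_density M \<xi> f t \<phi>
       * indicator {t<..} r"

definition random_vector_in ::
    "'a::euclidean_space set \<Rightarrow> 'b measure \<Rightarrow> ('b \<Rightarrow> 'a) \<Rightarrow> bool" where
  "random_vector_in E M \<eta> \<longleftrightarrow>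
     prob_space M \<and> \<eta> \<in> borel_measurable M \<and> (AE \<omega> in M. \<eta> \<omega> \<in> E)"

definition has_polar_density ::
    "'a::euclidean_space set \<Rightarrow> 'b measure \<Rightarrow> ('b \<Rightarrow> 'a) \<Rightarrow> (real \<Rightarrow> 'a \<Rightarrow> real) \<Rightarrow> bool" where
  "has_polar_density E M \<eta> g \<longleftrightarrow>
     distributed M (polar_measure E) (\<lambda>\<omega>. (norm (\<eta> \<omega>), \<eta> \<omega> /\<^sub>R norm (\<eta> \<omega>)))
       (\<lambda>(r, \<phi>). ennreal (g r \<phi>))"

definition M0 :: "'a::euclidean_space set \<Rightarrow> 'a measure set" where
  "M0 E = {\<mu>. sets \<mu> = sets (restrict_space borel (E - {0})) \<and>
              (\<forall>r>0. emeasure \<mu> {z \<in> E - {0}. norm z > r} < \<infinity>)}"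

text \<open>
  Boundaries are taken in the subspace \<open>E - {0}\<close> on which the measures live, not in the
  ambient space.
\<close>

definition tendsto_M0 ::
    "'a::euclidean_space set \<Rightarrow> ('i \<Rightarrow> 'a measure) \<Rightarrow> 'a measure \<Rightarrow> 'i filter \<Rightarrow> bool" where
  "tendsto_M0 E \<mu> \<nu> F \<longleftrightarrow>
     (\<forall>\<^sub>F i in F. \<mu> i \<in> M0 E) \<and> \<nu> \<in> M0 E \<and>
     (\<forall>B \<in> sets (restrict_space borel (E - {0})).
        emeasure \<nu> (top_of_set (E - {0}) frontier_of B) = 0 \<and> 0 \<notin> closure B \<longrightarrow>
        ((\<lambda>i. emeasure (\<mu> i) B) \<longlongrightarrow> emeasure \<nu> B) F)"

text \<open>
  The indicator extends \<open>\<phi>s\<close> by \<open>0\<close>: only its values on \<open>E - {0}\<close> are meaningful,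
  and elsewhere it need not even be measurable.
\<close>

definition tail_measure ::
    "'a::euclidean_space set \<Rightarrow> real \<Rightarrow> ('a \<Rightarrow> real) \<Rightarrow> 'a measure" where
  "tail_measure E s \<phi>s =
     restrict_space
       (distr
          (density (polar_measure E)
             (\<lambda>(r, \<phi>). ennreal (r powr (-(s + 1)) * \<phi>s \<phi>) * indicator (cone_sphere E) \<phi>))
          borel (\<lambda>(r, \<phi>). r *\<^sub>R \<phi>))
       (E - {0})"

text \<open>
  Each member of the family may live on its own probability space \<open>N u\<close>.
\<close>

definition tail_preserving ::
    "'a::euclidean_space set \<Rightarrow> real \<Rightarrow> ('a \<Rightarrow> real) \<Rightarrow>
     (real \<Rightarrow> 'c measure) \<Rightarrow> (real \<Rightarrow> 'c \<Rightarrow> 'a) \<Rightarrow> bool" where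
  "tail_preserving E s \<phi>s N \<eta> \<longleftrightarrow>
     (\<forall>u>0. random_vector_in E (N u) (\<eta> u)) \<and>
     tendsto_M0 E
       (\<lambda>u. scale_measure (ennreal (u powr s))
              (restrict_space (distr (N u) borel (\<lambda>\<omega>. \<eta> u \<omega> /\<^sub>R u)) (E - {0})))
       (tail_measure E s \<phi>s) at_top"

end

theory Submission
  imports Defs "HOL-Real_Asymp.Real_Asymp"
begin

text \<open>
  Beyond the threshold \<open>t\<close> the generated density is \<open>r powr (-(s+1)) * D t \<phi>\<close>, where
  \<open>D t \<phi> = s * t powr s * (integral of the polar density over r > t)\<close>: the tail probability
  cancels. Regular variation is uniform on the compact set of directions, on which the continuous
  limit density is bounded away from \<open>0\<close>; hence both \<open>r powr (s+1)\<close> times the polar density and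
  \<open>D t\<close> lie within a factor \<open>1 \<plusminus> e\<close> of the limit density, which gives the uniform ratio.
  If \<open>B\<close> keeps distance \<open>d\<close> from \<open>0\<close> and \<open>t(u) < d * u\<close>, only the part beyond the threshold
  charges \<open>u B\<close>. The substitution \<open>r = u * r'\<close> then shows that the scaled law of \<open>B\<close> is the tail
  measure of \<open>B\<close> with the limit density replaced by \<open>D (t u)\<close>, so it converges for every such
  \<open>B\<close>, without any condition on its boundary.
\<close>

section \<open>Tails of power laws\<close>

lemma nn_integral_powr_tail:
  fixes s t :: real
  assumes "s > 0" "t > 0"
  shows "(\<integral>\<^sup>+r. ennreal (r powr (-(s+1))) * indicator {t<..} r \<partial>lborel) = ennreal (t powr (-s) / s)"
proof -
  have "(\<integral>\<^sup>+r. ennreal (r powr (-(s+1))) * indicator {t<..} r \<partial>lborel)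
      = (\<integral>\<^sup>+r. ennreal (r powr (-(s+1))) * indicator {t..} r \<partial>lborel)"
    \<comment> \<open>The fundamental theorem is applied on a closed half-line; the added endpoint
      is a null set.\<close>
    by (rule nn_integral_cong_AE, use AE_lborel_singleton[of t] in eventually_elim)
       (auto simp: indicator_def)
  also have "\<dots> = ennreal (0 - (- (t powr (-s)) / s))"
  proof (rule nn_integral_FTC_atLeast)
    fix x assume "t \<le> x"
    then have "x > 0" using assms by simp
    then show "DERIV (\<lambda>x. - (x powr (-s)) / s) x :> x powr (-(s+1))"
      using assms by (auto intro!: derivative_eq_intros simp: minus_diff_commute)
  next
    show "((\<lambda>x. - (x powr - s) / s) \<longlongrightarrow> 0) at_top"
      using tendsto_divide[OF tendsto_minus[OF tendsto_neg_powr[OF _ filterlim_ident, of "-s"]] tendsto_const, of s]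
        assms by simp
  qed auto
  finally show ?thesis by simp
qed

lemma powr_tail_integral:
  fixes s t :: real
  assumes "s > 0" "t > 0"
  shows "set_integrable lborel {t<..} (\<lambda>r. r powr (-(s+1)))"
    and "(LINT r:{t<..}|lborel. r powr (-(s+1))) = t powr (-s) / s"
proof -
  have "has_bochner_integral lborel (\<lambda>r. indicator {t<..} r *\<^sub>R r powr (-(s+1))) (t powr (-s) / s)"
  proof (rule has_bochner_integral_nn_integral)
    have "(\<integral>\<^sup>+r. ennreal (indicator {t<..} r *\<^sub>R r powr (-(s+1))) \<partial>lborel)
      = (\<integral>\<^sup>+r. ennreal (r powr (-(s+1))) * indicator {t<..} r \<partial>lborel)"
      by (intro nn_integral_cong) (auto simp: indicator_def)
    then show "(\<integral>\<^sup>+r. ennreal (indicator {t<..} r *\<^sub>R r powr (-(s+1))) \<partial>lborel) = ennreal (t powr (-s) / s)"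
      using nn_integral_powr_tail[OF assms] by simp
  qed (use assms in auto)
  then show "set_integrable lborel {t<..} (\<lambda>r. r powr (-(s+1)))"
    and "(LINT r:{t<..}|lborel. r powr (-(s+1))) = t powr (-s) / s"
    by (auto simp: has_bochner_integral_iff set_integrable_def set_lebesgue_integral_def)
qed

section \<open>Unit sphere of the cone, surface measure and polar integration\<close>

lemma compact_cone_sphere: "closed E \<Longrightarrow> compact (cone_sphere E)"
proof -
  assume "closed E"
  moreover have "cone_sphere E = sphere 0 1 \<inter> E"
    by (auto simp: cone_sphere_def)
  ultimately show ?thesis
    by (simp add: compact_Int_closed)
qed

lemma cone_sphere_scaleR: "cone E \<Longrightarrow> \<phi> \<in> cone_sphere E \<Longrightarrow> 0 \<le> r \<Longrightarrow> r *\<^sub>R \<phi> \<in> E"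
  by (auto simp: cone_def cone_sphere_def)

text \<open>The total mass is \<open>DIM('a)\<close> times the volume of the unit ball.\<close>

lemma finite_measure_sphere_measure: "finite_measure (sphere_measure :: 'a::euclidean_space measure)"
proof
  have [measurable]: "(cball 0 1 :: 'a set) \<in> sets borel"
    by simp
  have "emeasure sphere_measure (space (sphere_measure :: 'a measure))
      = emeasure (density lborel (\<lambda>z. ennreal (real DIM('a)) * indicator (cball 0 1) z)) (UNIV :: 'a set)"
    by (simp add: sphere_measure_def emeasure_distr)
  also have "\<dots> = (\<integral>\<^sup>+z. ennreal (real DIM('a)) * indicator (cball 0 1) z \<partial>(lborel :: 'a measure))"
    by (subst emeasure_density) simp_all
  also have "\<dots> = ennreal (real DIM('a)) * emeasure lborel (cball 0 1 :: 'a set)"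
    by (simp add: nn_integral_cmult_indicator)
  also have "\<dots> < \<infinity>"
    using emeasure_lborel_cball_finite[of "0::'a" 1] by (simp add: ennreal_mult_less_top)
  finally show "emeasure sphere_measure (space (sphere_measure :: 'a measure)) \<noteq> \<infinity>"
    by simp
qed

lemma sets_sphere_measure [measurable_cong]: "sets sphere_measure = sets borel"
  by (simp add: sphere_measure_def)

lemma space_sphere_measure [simp]: "space sphere_measure = UNIV"
  by (simp add: sphere_measure_def)

lemma sets_polar_measure [measurable_cong]:
  "sets (polar_measure E) = sets (borel \<Otimes>\<^sub>M borel)"
  unfolding polar_measure_def by (intro sets_pair_measure_cong) (simp_all add: sets_sphere_measure)

lemma space_polar_measure [simp]: "space (polar_measure E) = UNIV"
  using sets_eq_imp_space_eq[OF sets_polar_measure] by (simp add: space_pair_measure)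

text \<open>Tonelli with the radius innermost, so that each direction can be treated on its own ray.
  Closedness of \<open>E\<close> makes its set of directions Borel, and the indicator densities
  reappear as factors of the integrand.\<close>

lemma nn_integral_polar_measure:
  fixes E :: "'a::euclidean_space set"
  assumes "closed E" and [measurable]: "h \<in> borel_measurable (borel \<Otimes>\<^sub>M borel)"
  shows "(\<integral>\<^sup>+x. h x \<partial>polar_measure E) =
    (\<integral>\<^sup>+\<phi>. indicator (cone_sphere E) \<phi> * (\<integral>\<^sup>+r. indicator {0<..} r * h (r, \<phi>) \<partial>lborel) \<partial>sphere_measure)"
proof -
  have [measurable]: "cone_sphere E \<in> sets borel"
    using compact_cone_sphere[OF assms(1)] by (simp add: compact_imp_closed)
  let ?A = "density lborel (indicator {0<..}) :: real measure"
  let ?B = "density sphere_measure (indicator (cone_sphere E)) :: 'a measure"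
  have "sigma_finite_measure ?A"
    by (subst sigma_finite_measure.sigma_finite_iff_density_finite[OF sigma_finite_lborel]) (auto simp: indicator_def)
  moreover have "finite_measure ?B"
  proof
    have "emeasure ?B (space ?B) = emeasure sphere_measure (cone_sphere E)"
      by (subst emeasure_density) (auto simp: nn_integral_indicator)
    then show "emeasure ?B (space ?B) \<noteq> \<infinity>"
      using finite_measure.emeasure_finite[OF finite_measure_sphere_measure] by simp
  qed
  ultimately interpret pair_sigma_finite ?A ?B
    by (simp add: pair_sigma_finite_def finite_measure.sigma_finite_measure)
  have h: "h \<in> borel_measurable (?A \<Otimes>\<^sub>M ?B)"
    by measurable
  have "(\<integral>\<^sup>+x. h x \<partial>polar_measure E) = (\<integral>\<^sup>+\<phi>. (\<integral>\<^sup>+r. h (r, \<phi>) \<partial>?A) \<partial>?B)"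
    unfolding polar_measure_def using nn_integral_snd[OF h] by simp
  also have "\<dots> = (\<integral>\<^sup>+\<phi>. (\<integral>\<^sup>+r. indicator {0<..} r * h (r, \<phi>) \<partial>lborel) \<partial>?B)"
    by (simp add: nn_integral_density)
  also have "\<dots> = (\<integral>\<^sup>+\<phi>. indicator (cone_sphere E) \<phi> * (\<integral>\<^sup>+r. indicator {0<..} r * h (r, \<phi>) \<partial>lborel) \<partial>sphere_measure)"
    by (subst nn_integral_density) simp_all
  finally show ?thesis .
qed

text \<open>Shrinking the part outside the ball by the factors \<open>1 / Suc n\<close> covers all
  of \<open>E\<close> except the origin, and each of these countably many linear images of a null
  set is null.\<close>

lemma negligible_cone:
  fixes E :: "'a::euclidean_space set"
  assumes "cone E" and null: "negligible (E - cball 0 t)" 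
  shows "negligible E"
proof -
  have "E - {0} \<subseteq> (\<Union>n. (\<lambda>z. (1 / real (Suc n)) *\<^sub>R z) ` (E - cball 0 t))"
  proof
    fix z assume z: "z \<in> E - {0}"
    \<comment> \<open>This \<open>n\<close> makes the multiple of \<open>z\<close> by
      \<open>Suc n\<close> leave the ball; the absolute value allows a negative
      \<open>t\<close>.\<close>
    obtain n where n: "\<bar>t\<bar> / norm z < real n"
      using reals_Archimedean2 by blast
    have "\<bar>t\<bar> < real n * norm z"
      using n z by (simp add: field_simps)
    also have "\<dots> \<le> real (Suc n) * norm z"
      by (simp add: mult_right_mono)
    finally have "real (Suc n) *\<^sub>R z \<in> E - cball 0 t"
      using z \<open>cone E\<close> by (auto simp: cone_def)
    then show "z \<in> (\<Union>n. (\<lambda>z. (1 / real (Suc n)) *\<^sub>R z) ` (E - cball 0 t))"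
      by (intro UN_I[of n] image_eqI[of _ _ "real (Suc n) *\<^sub>R z"]) (simp_all del: of_nat_Suc)
  qed
  moreover have "negligible (\<Union>n. (\<lambda>z. (1 / real (Suc n)) *\<^sub>R z) ` (E - cball 0 t))"
    by (intro negligible_countable_Union) 
       (auto intro!: negligible_differentiable_image_negligible[OF order_refl null] linear_imp_differentiable_on linear_scaleR)
  ultimately have "negligible (E - {0})"
    by (rule negligible_subset[rotated])
  then show ?thesis
    by (rule negligible_subset[OF negligible_Un[OF _ negligible_sing[of 0]]]) auto
qed

section \<open>Regular variation on the unit sphere of the cone\<close>

context
  fixes M :: "'b measure" and \<xi> :: "'b \<Rightarrow> 'a::euclidean_space"
    and E :: "'a set" and f :: "'a \<Rightarrow> real" and s :: real and \<phi>s :: "'a \<Rightarrow> real"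
  assumes E: "closed E" "cone E"
    and M: "prob_space M"
    and f_nonneg: "\<And>z. f z \<ge> 0"
    and f_distr: "distributed M lborel \<xi> (\<lambda>z. ennreal (f z))"
    and f_supp: "\<And>z. z \<notin> E \<Longrightarrow> f z = 0"
    and rv: "density_regularly_varying E f s \<phi>s"
begin

text \<open>This is \<open>D\<close> from the opening comment. Leaving out the tail probability lets
  it be bounded without knowing that this probability is positive.\<close>

definition scaled_angular_density :: "real \<Rightarrow> 'a \<Rightarrow> real" where
  "scaled_angular_density t \<phi> = s * t powr s * (LINT r:{t<..}|lborel. polar_density f r \<phi>)"

lemma s_pos: "s > 0"
  using rv by (simp add: density_regularly_varying_def)

text \<open>\<open>distributed\<close> yields measurability of \<open>ennreal (f z)\<close> only; as
  \<open>f\<close> is nonnegative, nothing is lost in going back to the reals.\<close>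

lemma f_measurable [measurable]: "f \<in> borel_measurable borel"
proof -
  have "(\<lambda>z. ennreal (f z)) \<in> borel_measurable borel"
    using distributed_borel_measurable[OF f_distr] by simp
  then have "(\<lambda>z. enn2real (ennreal (f z))) \<in> borel_measurable borel"
    by measurable
  then show ?thesis
    by (simp add: f_nonneg)
qed

lemma cone_sphere_measurable [measurable]: "cone_sphere E \<in> sets borel"
  using compact_cone_sphere[OF E(1)] by (simp add: compact_imp_closed)

text \<open>On a null cone the density would vanish almost everywhere, and the total mass would be 0
  instead of 1.\<close>

lemma not_negligible_cone: "\<not> negligible E"
proof
  assume "negligible E"
  moreover have "E \<in> sets borel"
    using E(1) by simp
  ultimately have "E \<in> null_sets lborel"
    by (simp add: negligible_iff_null_sets null_sets_completion_iff)
  then have "AE z in lborel. z \<notin> E"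
    by (rule AE_not_in)
  then have "(\<integral>\<^sup>+z. ennreal (f z) \<partial>lborel) = (\<integral>\<^sup>+z. 0 \<partial>(lborel :: 'a measure))"
    by (intro nn_integral_cong_AE) (auto simp: f_supp)
  moreover have "emeasure M (\<xi> -` UNIV \<inter> space M) = (\<integral>\<^sup>+z. ennreal (f z) * indicator UNIV z \<partial>lborel)"
    by (rule distributed_emeasure[OF f_distr]) simp
  ultimately show False
    using prob_space.emeasure_space_1[OF M] by simp
qed

text \<open>Without unit vectors the cone would be contained in \<open>{0}\<close> and hence null.
  The extrema of the limit density and the nonnegativity of the supremum of the ratio errors depend
  on this.\<close>

lemma cone_sphere_nonempty: "cone_sphere E \<noteq> {}"
proof
  assume *: "cone_sphere E = {}"
  have "z = 0" if "z \<in> E" for z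
  proof (rule ccontr)
    assume "z \<noteq> 0"
    with that E(2) have "inverse (norm z) *\<^sub>R z \<in> cone_sphere E"
      by (auto simp: cone_sphere_def cone_def)
    with * show False by simp
  qed
  then have "E \<subseteq> {0}" by auto
  then show False
    using not_negligible_cone negligible_subset[of "{0}" E] by auto
qed

text \<open>A uniform limit of continuous functions is continuous, and a positive continuous
  function on a nonempty compact set has a positive minimum.\<close>

lemma limit_density_cone_sphere:
  shows "continuous_on (cone_sphere E) \<phi>s"
    and "\<exists>c>0. \<forall>\<phi>\<in>cone_sphere E. c \<le> \<phi>s \<phi>"
    and "uniform_limit (cone_sphere E) (\<lambda>t z. t powr (s + real DIM('a)) * f (t *\<^sub>R z)) \<phi>s at_top"
proof -
  obtain r0 where r0: "r0 > 0" "continuous_on (E - cball 0 r0) f"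
    using rv by (auto simp: density_regularly_varying_def)
  have sub: "cone_sphere E \<subseteq> E - {0}"
    by (auto simp: cone_sphere_def)
  show lim: "uniform_limit (cone_sphere E) (\<lambda>t z. t powr (s + real DIM('a)) * f (t *\<^sub>R z)) \<phi>s at_top"
    using rv compact_cone_sphere[OF E(1)] sub by (auto simp: density_regularly_varying_def)
  \<comment> \<open>For \<open>t > r0\<close> the sphere scaled by \<open>t\<close> lies in the
    region where \<open>f\<close> is continuous.\<close>
  have "\<forall>\<^sub>F t in at_top. continuous_on (cone_sphere E) (\<lambda>z. t powr (s + real DIM('a)) * f (t *\<^sub>R z))"
    using eventually_gt_at_top[of r0]
  proof eventually_elim
    case (elim t)
    have "continuous_on (cone_sphere E) (\<lambda>z. f (t *\<^sub>R z))"
      by (rule continuous_on_compose2[OF r0(2)])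
         (use elim r0(1) E(2) in \<open>auto intro!: continuous_intros cone_sphere_scaleR simp: cone_sphere_def cone_def\<close>)
    then show ?case
      by (intro continuous_intros)
  qed
  then show cont: "continuous_on (cone_sphere E) \<phi>s"
    by (rule uniform_limit_theorem[OF _ lim]) simp
  obtain x where x: "x \<in> cone_sphere E" "\<forall>y\<in>cone_sphere E. \<phi>s x \<le> \<phi>s y"
    using continuous_attains_inf[OF compact_cone_sphere[OF E(1)] cone_sphere_nonempty cont] by blast
  moreover have "\<phi>s x > 0"
    using rv x(1) sub by (auto simp: density_regularly_varying_def)
  ultimately show "\<exists>c>0. \<forall>\<phi>\<in>cone_sphere E. c \<le> \<phi>s \<phi>"
    by blast
qed

lemma limit_density_pos: "\<phi> \<in> cone_sphere E \<Longrightarrow> \<phi>s \<phi> > 0"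
  using limit_density_cone_sphere(2) by fastforce

text \<open>The lower bound \<open>c\<close> of \<open>\<phi>s\<close> turns the uniform absolute
  error \<open>e * c\<close> into the relative error \<open>e\<close>. Closeness at all scales from
  \<open>T\<close> on covers every radius above \<open>t \<ge> T\<close> at once.\<close>

lemma polar_density_bounds:
  assumes "e > 0"
  shows "\<forall>\<^sub>F t in at_top. \<forall>r>t. \<forall>\<phi>\<in>cone_sphere E.
    (1 - e) * \<phi>s \<phi> * r powr (-(s+1)) \<le> polar_density f r \<phi> \<and>
    polar_density f r \<phi> \<le> (1 + e) * \<phi>s \<phi> * r powr (-(s+1))"
proof -
  obtain c where c: "c > 0" "\<And>\<phi>. \<phi> \<in> cone_sphere E \<Longrightarrow> c \<le> \<phi>s \<phi>"
    using limit_density_cone_sphere(2) by blast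
  have "\<forall>\<^sub>F t in at_top. \<forall>\<phi>\<in>cone_sphere E. dist (t powr (s + real DIM('a)) * f (t *\<^sub>R \<phi>)) (\<phi>s \<phi>) < e * c"
    using uniform_limitD[OF limit_density_cone_sphere(3)] assms c(1) by simp
  then obtain T where T: "\<And>t \<phi>. t \<ge> T \<Longrightarrow> \<phi> \<in> cone_sphere E \<Longrightarrow>
      dist (t powr (s + real DIM('a)) * f (t *\<^sub>R \<phi>)) (\<phi>s \<phi>) < e * c"
    unfolding eventually_at_top_linorder by blast
  show ?thesis
    using eventually_ge_at_top[of "max T 0"]
  proof eventually_elim
    case (elim t)
    show ?case
    proof (intro allI impI ballI)
      fix r \<phi> assume r: "r > t" and \<phi>: "\<phi> \<in> cone_sphere E"
      let ?A = "r powr (s + real DIM('a)) * f (r *\<^sub>R \<phi>)"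
      have pos: "r > 0" using r elim by simp
      \<comment> \<open>The exponent of the polar factor splits as \<open>(s + d) - (s + 1)\<close>
        with \<open>d\<close> the dimension; the truncated subtraction is exact because the
        dimension is at least 1.\<close>
      have "real (DIM('a) - 1) = real DIM('a) - 1"
        by (simp add: of_nat_diff Suc_leI)
      then have "r ^ (DIM('a) - 1) = r powr (s + real DIM('a)) * r powr (-(s+1))"
        using pos by (simp add: powr_realpow[symmetric] powr_add[symmetric])
      then have eq: "polar_density f r \<phi> = ?A * r powr (-(s+1))"
        by (simp add: polar_density_def)
      have "e * c \<le> e * \<phi>s \<phi>"
        using c(2)[OF \<phi>] assms by simp
      moreover have "\<bar>?A - \<phi>s \<phi>\<bar> < e * c"
        using T[of r \<phi>] r elim \<phi> by (simp add: dist_real_def)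
      ultimately have "(1 - e) * \<phi>s \<phi> \<le> ?A" "?A \<le> (1 + e) * \<phi>s \<phi>"
        by (auto simp: algebra_simps)
      then show "(1 - e) * \<phi>s \<phi> * r powr (-(s+1)) \<le> polar_density f r \<phi> \<and>
          polar_density f r \<phi> \<le> (1 + e) * \<phi>s \<phi> * r powr (-(s+1))"
        unfolding eq by (auto intro!: mult_right_mono)
    qed
  qed
qed

text \<open>The two-sided radial bound is integrated over \<open>r > t\<close>; the prefactor
  \<open>s * t powr s\<close> cancels the power-law tail \<open>t powr (-s) / s\<close>.\<close>

lemma scaled_angular_density_bounds:
  assumes "e > 0"
  shows "\<forall>\<^sub>F t in at_top. \<forall>\<phi>\<in>cone_sphere E.
    (1 - e) * \<phi>s \<phi> \<le> scaled_angular_density t \<phi> \<and> scaled_angular_density t \<phi> \<le> (1 + e) * \<phi>s \<phi>"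
  using polar_density_bounds[OF assms] eventually_gt_at_top[of 0]
proof eventually_elim
  case (elim t)
  show ?case
  proof
    fix \<phi> assume \<phi>: "\<phi> \<in> cone_sphere E"
    note powr_int = powr_tail_integral[OF s_pos elim(2)]
    have meas: "set_borel_measurable lborel {t<..} (\<lambda>r. polar_density f r \<phi>)"
      unfolding set_borel_measurable_def polar_density_def by measurable
    have int_c: "set_integrable lborel {t<..} (\<lambda>r. k * r powr (-(s+1)))"
      and val_c: "(LINT r:{t<..}|lborel. k * r powr (-(s+1))) = k * (t powr (-s) / s)" for k
      using powr_int by simp_all
    have nonneg: "0 \<le> polar_density f r \<phi>" if "r > t" for r
      using that elim(2) f_nonneg by (simp add: polar_density_def)
    \<comment> \<open>Integrability comes first: without it the integral would be 0 by convention
      and monotonicity would not apply.\<close>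
    have int: "set_integrable lborel {t<..} (\<lambda>r. polar_density f r \<phi>)"
      by (rule set_integrable_bound[OF int_c meas, of "(1 + e) * \<phi>s \<phi>"])
         (use elim \<phi> nonneg in \<open>force intro!: AE_I2\<close>)
    have cancel: "s * t powr s * (k * (t powr (-s) / s)) = k" for k
      using s_pos elim(2) by (simp add: powr_minus field_simps)
    have "(1 - e) * \<phi>s \<phi> * (t powr (-s) / s) \<le> (LINT r:{t<..}|lborel. polar_density f r \<phi>)"
      unfolding val_c[symmetric] by (rule set_integral_mono[OF int_c int]) (use elim \<phi> in auto)
    from mult_left_mono[OF this, of "s * t powr s"]
    have lower: "(1 - e) * \<phi>s \<phi> \<le> scaled_angular_density t \<phi>"
      unfolding scaled_angular_density_def cancel using s_pos by simp
    have "(LINT r:{t<..}|lborel. polar_density f r \<phi>) \<le> (1 + e) * \<phi>s \<phi> * (t powr (-s) / s)"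
      unfolding val_c[symmetric] by (rule set_integral_mono[OF int int_c]) (use elim \<phi> in auto)
    from mult_left_mono[OF this, of "s * t powr s"]
    have "scaled_angular_density t \<phi> \<le> (1 + e) * \<phi>s \<phi>"
      unfolding scaled_angular_density_def cancel using s_pos by simp
    with lower show "(1 - e) * \<phi>s \<phi> \<le> scaled_angular_density t \<phi> \<and> scaled_angular_density t \<phi> \<le> (1 + e) * \<phi>s \<phi>"
      by blast
  qed
qed

text \<open>
  Needed because \<open>inverse 0 = 0\<close> would make the angular density vanish. If the tail probability
  is \<open>0\<close>, then \<open>E\<close> is null outside a ball, hence null as a cone.
\<close>

lemma radial_tail_pos: "\<forall>\<^sub>F t in at_top. radial_tail M \<xi> t > 0"
  using polar_density_bounds[of "1/2", simplified] eventually_gt_at_top[of 0]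
proof eventually_elim
  case (elim t)
  \<comment> \<open>The lower bound with \<open>e = 1/2\<close>, taken at radius
    \<open>norm z\<close>, is strictly positive, so \<open>f\<close> cannot vanish at far points of
    the cone.\<close>
  have f_pos: "f z > 0" if z: "z \<in> E - cball 0 t" for z
  proof -
    define \<phi> where "\<phi> = inverse (norm z) *\<^sub>R z"
    have norm: "norm z > t"
      using z by auto
    then have "z \<noteq> 0"
      using elim(2) by auto
    have \<phi>: "\<phi> \<in> cone_sphere E"
      using z \<open>z \<noteq> 0\<close> E(2) by (auto simp: \<phi>_def cone_sphere_def cone_def)
    have "0 < 1/2 * \<phi>s \<phi> * norm z powr (-(s+1))"
      using limit_density_pos[OF \<phi>] \<open>z \<noteq> 0\<close> by simp
    also have "\<dots> \<le> polar_density f (norm z) \<phi>"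
      using elim(1) norm \<phi> by auto
    finally have "0 < norm z ^ (DIM('a) - 1) * f (norm z *\<^sub>R \<phi>)"
      by (simp add: polar_density_def)
    then have "f (norm z *\<^sub>R \<phi>) \<noteq> 0"
      by auto
    moreover have "norm z *\<^sub>R \<phi> = z"
      using \<open>z \<noteq> 0\<close> by (simp add: \<phi>_def)
    ultimately show "f z > 0"
      using f_nonneg[of z] by simp
  qed
  have ms: "{z :: 'a. norm z > t} \<in> sets borel"
    by measurable
  show "radial_tail M \<xi> t > 0"
  proof (rule ccontr)
    assume "\<not> radial_tail M \<xi> t > 0"
    then have "measure M {\<omega> \<in> space M. norm (\<xi> \<omega>) > t} = 0"
      unfolding radial_tail_def by (simp add: zero_less_measure_iff)
    moreover have "\<xi> -` {z. norm z > t} \<inter> space M = {\<omega> \<in> space M. norm (\<xi> \<omega>) > t}"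
      by auto
    ultimately have "emeasure M (\<xi> -` {z. norm z > t} \<inter> space M) = 0"
      using M by (simp add: finite_measure.emeasure_eq_measure prob_space.finite_measure)
    then have "(\<integral>\<^sup>+z. ennreal (f z) * indicator {z. norm z > t} z \<partial>lborel) = 0"
      using distributed_emeasure[OF f_distr, of "{z. norm z > t}"] ms by simp
    then have "AE z in lborel. ennreal (f z) * indicator {z. norm z > t} z = 0"
      by (subst (asm) nn_integral_0_iff_AE) (use ms in auto)
    \<comment> \<open>A product that vanishes almost everywhere keeps almost every point out of the
      region where both factors are positive.\<close>
    then have "AE z in lborel. z \<notin> E - cball 0 t"
    proof eventually_elim
      case (elim z)
      show ?case
      proof
        assume "z \<in> E - cball 0 t"
        with f_pos[OF this] elim show False
          by (auto simp: indicator_def split: if_splits)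
      qed
    qed
    moreover have "E - cball 0 t \<in> sets lborel"
      using E(1) by simp
    ultimately have "E - cball 0 t \<in> null_sets lborel"
      by (subst AE_iff_null_sets) simp_all
    then have "negligible (E - cball 0 t)"
      by (simp add: negligible_iff_null_sets null_sets_completionI)
    then show False
      using negligible_cone[OF E(2)] not_negligible_cone by blast
  qed
qed

section \<open>Uniform convergence of the density ratio\<close>

lemma gen_density_tail:
  assumes "radial_tail M \<xi> t > 0" "r > t"
  shows "gen_density M \<xi> f s t r \<phi> = r powr (-(s+1)) * scaled_angular_density t \<phi>"
  using assms by (simp add: gen_density_def scaled_angular_density_def angular_density_def)

text \<open>Numerator and denominator both lie between
  \<open>(1 - d) * \<phi>s \<phi> * r powr (-(s+1))\<close> and the same expression with
  \<open>1 + d\<close>, so the quotient differs from 1 by at most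
  \<open>2 * d / (1 - d)\<close>.\<close>

lemma density_ratio_uniform:
  "((\<lambda>t. SUP (r, \<phi>)\<in>{t<..} \<times> cone_sphere E.
      ereal \<bar>polar_density f r \<phi> / gen_density M \<xi> f s t r \<phi> - 1\<bar>) \<longlongrightarrow> 0) at_top"
  (is "(?S \<longlongrightarrow> 0) at_top")
proof -
  have bound: "\<forall>\<^sub>F t in at_top. 0 \<le> ?S t \<and> ?S t \<le> ereal e" if e: "e > 0" for e
  proof -
    \<comment> \<open>The solution of \<open>2 * d / (1 - d) = e\<close>.\<close>
    define d where "d = e / (e + 2)"
    have d: "d > 0" "d < 1" "2 * d = e * (1 - d)"
      using e by (auto simp: d_def field_simps)
    show ?thesis
      using polar_density_bounds[OF d(1)] scaled_angular_density_bounds[OF d(1)] radial_tail_pos eventually_gt_at_top[of 0]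
    proof eventually_elim
      case (elim t)
      have le: "\<bar>polar_density f r \<phi> / gen_density M \<xi> f s t r \<phi> - 1\<bar> \<le> e"
        if r: "r > t" and \<phi>: "\<phi> \<in> cone_sphere E" for r \<phi>
      proof -
        define p where "p = r powr (-(s+1))"
        define D where "D = scaled_angular_density t \<phi>"
        define P where "P = polar_density f r \<phi>"
        have p: "p > 0"
          using r elim(4) by (simp add: p_def)
        have v: "\<phi>s \<phi> > 0"
          using limit_density_pos[OF \<phi>] .
        have D: "(1 - d) * \<phi>s \<phi> \<le> D" "D \<le> (1 + d) * \<phi>s \<phi>"
          using elim(2) \<phi> by (auto simp: D_def)
        have P: "(1 - d) * \<phi>s \<phi> * p \<le> P" "P \<le> (1 + d) * \<phi>s \<phi> * p"
          using elim(1) r \<phi> by (auto simp: P_def p_def)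
        have "0 < (1 - d) * \<phi>s \<phi>"
          using d v by simp
        with D(1) have D0: "D > 0" by linarith
        have "(1 - d) * \<phi>s \<phi> * p \<le> p * D" "p * D \<le> (1 + d) * \<phi>s \<phi> * p"
          using mult_left_mono[OF D(1), of p] mult_left_mono[OF D(2), of p] p
          by (simp_all add: mult_ac)
        \<comment> \<open>The two numbers differ by at most the length of their common interval; its
          lower end, which is at most \<open>p * D\<close>, then makes the error relative to the
          denominator.\<close>
        with P have "\<bar>P - p * D\<bar> \<le> 2 * d * (\<phi>s \<phi> * p)"
          by (simp add: algebra_simps abs_le_iff)
        also have "\<dots> = e * ((1 - d) * \<phi>s \<phi> * p)"
          by (simp add: d(3))
        also have "\<dots> \<le> e * (p * D)"
          using \<open>(1 - d) * \<phi>s \<phi> * p \<le> p * D\<close> e by simp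
        finally have "\<bar>P - p * D\<bar> / (p * D) \<le> e"
          using p D0 by (simp add: divide_le_eq)
        moreover have "P / (p * D) - 1 = (P - p * D) / (p * D)"
          using p D0 by (simp add: diff_divide_distrib)
        ultimately have "\<bar>P / (p * D) - 1\<bar> \<le> e"
          using p D0 by simp
        then show ?thesis
          using gen_density_tail[OF elim(3) r] by (simp add: P_def p_def D_def)
      qed
      \<comment> \<open>The supremum of the empty set would be \<open>-\<infinity>\<close>; the pair
        \<open>(t + 1, \<phi>)\<close> supplies a nonnegative member.\<close>
      obtain \<phi> where \<phi>: "\<phi> \<in> cone_sphere E"
        using cone_sphere_nonempty by blast
      have "0 \<le> ereal \<bar>polar_density f (t + 1) \<phi> / gen_density M \<xi> f s t (t + 1) \<phi> - 1\<bar>"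
        by simp
      also have "\<dots> \<le> ?S t"
        by (rule SUP_upper2[of "(t + 1, \<phi>)"]) (use \<phi> in auto)
      finally have "0 \<le> ?S t" .
      moreover have "?S t \<le> ereal e"
        by (rule SUP_least) (use le in auto)
      ultimately show ?case by blast
    qed
  qed
  show ?thesis
  proof (rule order_tendstoI)
    fix a :: ereal assume "a < 0"
    show "\<forall>\<^sub>F t in at_top. a < ?S t"
      using bound[of 1, OF zero_less_one] \<open>a < 0\<close> by (auto elim!: eventually_mono intro: less_le_trans)
  next
    fix a :: ereal assume "0 < a"
    then obtain e :: real where "0 < ereal e" "ereal e < a"
      using ereal_dense2[of 0 a] by auto
    then show "\<forall>\<^sub>F t in at_top. ?S t < a"
      using bound[of e] by (auto elim!: eventually_mono)
  qed
qed

section \<open>The tail measure in polar coordinates\<close>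

text \<open>The factor shared by the two measures to be compared: the tail measure integrates it
  against \<open>\<phi>s\<close>, the scaled generated law against \<open>D\<close>, so that only
  the angular weights differ.\<close>

definition radial_mass :: "'a set \<Rightarrow> 'a \<Rightarrow> ennreal" where
  "radial_mass B \<phi> =
     (\<integral>\<^sup>+r. indicator {0<..} r * (ennreal (r powr (-(s+1))) * indicator B (r *\<^sub>R \<phi>)) \<partial>lborel)"

lemma radial_mass_measurable [measurable]:
  assumes [measurable]: "B \<in> sets borel"
  shows "radial_mass B \<in> borel_measurable borel"
  unfolding radial_mass_def[abs_def] by measurable

text \<open>Continuity on the closed set of directions makes the extension by 0 Borel; off
  \<open>E - {0}\<close> the function \<open>\<phi>s\<close> may be arbitrary.\<close>

lemma limit_density_measurable [measurable]:
  "(\<lambda>\<phi>. indicator (cone_sphere E) \<phi> * ennreal (\<phi>s \<phi>)) \<in> borel_measurable borel"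
proof -
  have "(\<lambda>\<phi>. indicator (cone_sphere E) \<phi> *\<^sub>R \<phi>s \<phi>) \<in> borel_measurable borel"
    using borel_measurable_continuous_on_indicator[OF cone_sphere_measurable limit_density_cone_sphere(1)] .
  then have "(\<lambda>\<phi>. ennreal (indicator (cone_sphere E) \<phi> *\<^sub>R \<phi>s \<phi>)) \<in> borel_measurable borel"
    by measurable
  also have "(\<lambda>\<phi>. ennreal (indicator (cone_sphere E) \<phi> *\<^sub>R \<phi>s \<phi>)) = (\<lambda>\<phi>. indicator (cone_sphere E) \<phi> * ennreal (\<phi>s \<phi>))"
    by (auto simp: indicator_def)
  finally show ?thesis .
qed

lemma sets_punctured_cone: "E - {0} \<in> sets borel"
  using E(1) by auto

lemma sets_cone_outside: "{z \<in> E - {0}. norm z > r} \<in> sets borel"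
proof -
  have "{z \<in> E - {0}. norm z > r} = (E - {0}) \<inter> {z. norm z > r}"
    by auto
  moreover have "{z :: 'a. norm z > r} \<in> sets borel"
    by measurable
  ultimately show ?thesis
    using sets_punctured_cone by auto
qed

text \<open>Once the image under \<open>r *\<^sub>R \<phi>\<close> is pulled back and the integral
  is taken ray by ray, the weight \<open>\<phi>s \<phi>\<close> is constant on each ray and leaves
  the radial integral.\<close>

lemma emeasure_tail_measure:
  assumes B: "B \<in> sets borel" "B \<subseteq> E - {0}"
  shows "emeasure (tail_measure E s \<phi>s) B =
    (\<integral>\<^sup>+\<phi>. indicator (cone_sphere E) \<phi> * ennreal (\<phi>s \<phi>) * radial_mass B \<phi> \<partial>sphere_measure)"
proof -
  note [measurable] = B(1)
  let ?g = "\<lambda>(r, \<phi>). ennreal (r powr (-(s + 1)) * \<phi>s \<phi>) * indicator (cone_sphere E) \<phi>"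
  \<comment> \<open>The indicator is grouped with \<open>\<phi>s\<close>, as it is their product
    that is known to be measurable.\<close>
  have g_eq: "?g = (\<lambda>x. ennreal (fst x powr (-(s + 1))) * (indicator (cone_sphere E) (snd x) * ennreal (\<phi>s (snd x))))"
    by (auto simp: fun_eq_iff indicator_def ennreal_mult')
  have g: "?g \<in> borel_measurable (borel \<Otimes>\<^sub>M borel)"
    unfolding g_eq by measurable
  have g': "?g \<in> borel_measurable (polar_measure E)"
    using g by (simp add: measurable_cong_sets[OF sets_polar_measure refl])
  have T: "(\<lambda>(r, \<phi>). r *\<^sub>R \<phi>) \<in> borel \<Otimes>\<^sub>M borel \<rightarrow>\<^sub>M (borel :: 'a measure)"
    by measurable
  have T': "(\<lambda>(r, \<phi>). r *\<^sub>R \<phi>) \<in> density (polar_measure E) ?g \<rightarrow>\<^sub>M (borel :: 'a measure)"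
    using T by (simp add: measurable_cong_sets[OF sets_polar_measure refl])
  let ?V = "(\<lambda>(r, \<phi>). r *\<^sub>R \<phi>) -` B :: (real \<times> 'a) set"
  have V [measurable]: "?V \<in> sets (borel \<Otimes>\<^sub>M borel)"
    using measurable_sets[OF T B(1)] by (simp add: space_pair_measure)
  have "emeasure (tail_measure E s \<phi>s) B = emeasure (distr (density (polar_measure E) ?g) borel (\<lambda>(r, \<phi>). r *\<^sub>R \<phi>)) B"
    unfolding tail_measure_def using sets_punctured_cone B by (intro emeasure_restrict_space) auto
  also have "\<dots> = emeasure (density (polar_measure E) ?g) ?V"
    using emeasure_distr[OF T' B(1)] by simp
  also have "\<dots> = (\<integral>\<^sup>+x. ?g x * indicator ?V x \<partial>polar_measure E)"
    by (rule emeasure_density[OF g']) (simp add: sets_polar_measure V)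
  also have "\<dots> = (\<integral>\<^sup>+\<phi>. indicator (cone_sphere E) \<phi> * (\<integral>\<^sup>+r. indicator {0<..} r * (?g (r, \<phi>) * indicator ?V (r, \<phi>)) \<partial>lborel) \<partial>sphere_measure)"
    by (rule nn_integral_polar_measure[OF E(1)]) (use g in measurable)
  also have "\<dots> = (\<integral>\<^sup>+\<phi>. indicator (cone_sphere E) \<phi> * ennreal (\<phi>s \<phi>) * radial_mass B \<phi> \<partial>sphere_measure)"
  proof (rule nn_integral_cong)
    fix \<phi> :: 'a
    show "indicator (cone_sphere E) \<phi> * (\<integral>\<^sup>+r. indicator {0<..} r * (?g (r, \<phi>) * indicator ?V (r, \<phi>)) \<partial>lborel)
      = indicator (cone_sphere E) \<phi> * ennreal (\<phi>s \<phi>) * radial_mass B \<phi>"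
    proof (cases "\<phi> \<in> cone_sphere E")
      case True
      have "(\<integral>\<^sup>+r. indicator {0<..} r * (?g (r, \<phi>) * indicator ?V (r, \<phi>)) \<partial>lborel)
        = (\<integral>\<^sup>+r. ennreal (\<phi>s \<phi>) * (indicator {0<..} r * (ennreal (r powr (-(s+1))) * indicator B (r *\<^sub>R \<phi>))) \<partial>lborel)"
        using True by (intro nn_integral_cong) (auto simp: indicator_def ennreal_mult'' mult_ac)
      also have "\<dots> = ennreal (\<phi>s \<phi>) * radial_mass B \<phi>"
        unfolding radial_mass_def by (rule nn_integral_cmult) measurable
      finally show ?thesis using True by simp
    qed simp
  qed
  finally show ?thesis .
qed

text \<open>\<open>\<phi>s\<close> is bounded on the compact set of directions, the radial mass
  beyond \<open>d\<close> is at most \<open>d powr (-s) / s\<close>, and the surface measure is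
  finite.\<close>

lemma emeasure_tail_measure_finite:
  assumes "d > 0"
  shows "emeasure (tail_measure E s \<phi>s) {z \<in> E - {0}. norm z > d} < \<infinity>"
proof -
  obtain C where C: "\<And>\<phi>. \<phi> \<in> cone_sphere E \<Longrightarrow> \<phi>s \<phi> \<le> C"
    using continuous_attains_sup[OF compact_cone_sphere[OF E(1)] cone_sphere_nonempty limit_density_cone_sphere(1)] by blast
  have mass: "radial_mass {z \<in> E - {0}. norm z > d} \<phi> \<le> ennreal (d powr (-s) / s)" if "\<phi> \<in> cone_sphere E" for \<phi>
    unfolding radial_mass_def nn_integral_powr_tail[OF s_pos assms, symmetric]
    by (rule nn_integral_mono) (use that in \<open>auto simp: indicator_def cone_sphere_def\<close>)
  have "emeasure (tail_measure E s \<phi>s) {z \<in> E - {0}. norm z > d} \<le>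
      (\<integral>\<^sup>+\<phi>. ennreal C * ennreal (d powr (-s) / s) \<partial>(sphere_measure :: 'a measure))"
    unfolding emeasure_tail_measure[OF sets_cone_outside Collect_restrict]
  proof (rule nn_integral_mono)
    fix \<phi> :: 'a
    show "indicator (cone_sphere E) \<phi> * ennreal (\<phi>s \<phi>) * radial_mass {z \<in> E - {0}. norm z > d} \<phi>
        \<le> ennreal C * ennreal (d powr (-s) / s)"
    proof (cases "\<phi> \<in> cone_sphere E")
      case True
      then show ?thesis
        using mult_mono[OF ennreal_leI[OF C[OF True]] mass[OF True]] by simp
    qed simp
  qed
  also have "\<dots> = ennreal C * ennreal (d powr (-s) / s) * emeasure sphere_measure (UNIV :: 'a set)"
    by simp
  also have "\<dots> < \<infinity>"
    using finite_measure.emeasure_finite[OF finite_measure_sphere_measure, of "UNIV :: 'a set"]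
    by (simp add: ennreal_mult_less_top less_top)
  finally show ?thesis .
qed

section \<open>The scaled law of the generated vector\<close>

lemma scaled_angular_density_measurable [measurable]:
  "scaled_angular_density t \<in> borel_measurable borel"
  unfolding scaled_angular_density_def[abs_def] set_lebesgue_integral_def polar_density_def
  by measurable

text \<open>An exact identity, not only a limit: the generated tail is a pure power in
  \<open>r\<close>, so rescaling the radius by \<open>u\<close> produces precisely the factor
  \<open>u powr (-s)\<close>.\<close>

lemma emeasure_scaled_gen:
  assumes "u > 0" "d > 0" "0 < t" "t < d * u" and p: "radial_tail M \<xi> t > 0"
    and \<eta>: "has_polar_density E N \<eta> (gen_density M \<xi> f s t)" "\<eta> \<in> borel_measurable N"
    and B: "B \<in> sets borel" "B \<subseteq> E - {0}" "\<And>z. z \<in> B \<Longrightarrow> norm z \<ge> d"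
  shows "ennreal (u powr s) * emeasure N {\<omega> \<in> space N. \<eta> \<omega> /\<^sub>R u \<in> B} =
    (\<integral>\<^sup>+\<phi>. indicator (cone_sphere E) \<phi> * ennreal (scaled_angular_density t \<phi>) * radial_mass B \<phi> \<partial>sphere_measure)"
proof -
  note [measurable] = B(1)
  let ?g = "\<lambda>(r, \<phi>). ennreal (gen_density M \<xi> f s t r \<phi>)"
  let ?X = "\<lambda>\<omega>. (norm (\<eta> \<omega>), \<eta> \<omega> /\<^sub>R norm (\<eta> \<omega>))"
  let ?V = "{(r, \<phi>). (r / u) *\<^sub>R \<phi> \<in> B} :: (real \<times> 'a) set"
  have dist: "distributed N (polar_measure E) ?X ?g"
    using \<eta>(1) by (simp add: has_polar_density_def)
  have g [measurable]: "?g \<in> borel_measurable (borel \<Otimes>\<^sub>M borel)"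
    using distributed_borel_measurable[OF dist] by (simp add: measurable_cong_sets[OF sets_polar_measure refl])
  have T: "(\<lambda>(r, \<phi>). (r / u) *\<^sub>R \<phi>) \<in> borel \<Otimes>\<^sub>M borel \<rightarrow>\<^sub>M (borel :: 'a measure)"
    by measurable
  have "?V = (\<lambda>(r, \<phi>). (r / u) *\<^sub>R \<phi>) -` B \<inter> space (borel \<Otimes>\<^sub>M borel)"
    by (auto simp: space_pair_measure)
  then have V [measurable]: "?V \<in> sets (borel \<Otimes>\<^sub>M borel)"
    using measurable_sets[OF T B(1)] by simp
  have "{\<omega> \<in> space N. \<eta> \<omega> /\<^sub>R u \<in> B} = ?X -` ?V \<inter> space N"
  proof -
    \<comment> \<open>At the origin the direction is 0 because \<open>inverse 0 = 0\<close>, and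
      both sides vanish.\<close>
    have "(norm (\<eta> \<omega>) / u) *\<^sub>R (\<eta> \<omega> /\<^sub>R norm (\<eta> \<omega>)) = \<eta> \<omega> /\<^sub>R u" for \<omega>
      by (cases "\<eta> \<omega> = 0") (simp_all add: divide_inverse)
    then show ?thesis
      by (auto simp del: scaleR_scaleR)
  qed
  then have "emeasure N {\<omega> \<in> space N. \<eta> \<omega> /\<^sub>R u \<in> B} = (\<integral>\<^sup>+x. ?g x * indicator ?V x \<partial>polar_measure E)"
    using distributed_emeasure[OF dist, of ?V] V by (simp add: sets_polar_measure)
  also have "\<dots> = (\<integral>\<^sup>+\<phi>. indicator (cone_sphere E) \<phi> * (\<integral>\<^sup>+r. indicator {0<..} r * (?g (r, \<phi>) * indicator ?V (r, \<phi>)) \<partial>lborel) \<partial>sphere_measure)"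
    by (rule nn_integral_polar_measure[OF E(1)]) (use g in measurable)
  also have "\<dots> = (\<integral>\<^sup>+\<phi>. ennreal (u powr (-s)) * (indicator (cone_sphere E) \<phi> * (ennreal (scaled_angular_density t \<phi>) * radial_mass B \<phi>)) \<partial>sphere_measure)"
  proof (rule nn_integral_cong)
    fix \<phi> :: 'a
    show "indicator (cone_sphere E) \<phi> * (\<integral>\<^sup>+r. indicator {0<..} r * (?g (r, \<phi>) * indicator ?V (r, \<phi>)) \<partial>lborel)
      = ennreal (u powr (-s)) * (indicator (cone_sphere E) \<phi> * (ennreal (scaled_angular_density t \<phi>) * radial_mass B \<phi>))"
    proof (cases "\<phi> \<in> cone_sphere E")
      case True
      let ?D = "ennreal (scaled_angular_density t \<phi>)"
      let ?h = "\<lambda>r. indicator {0<..} r * (ennreal (r powr (-(s+1))) * indicator B ((r / u) *\<^sub>R \<phi>))"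
      have "(\<integral>\<^sup>+r. indicator {0<..} r * (?g (r, \<phi>) * indicator ?V (r, \<phi>)) \<partial>lborel) = (\<integral>\<^sup>+r. ?D * ?h r \<partial>lborel)"
      proof (rule nn_integral_cong)
        fix r :: real
        show "indicator {0<..} r * (?g (r, \<phi>) * indicator ?V (r, \<phi>)) = ?D * ?h r"
        proof (cases "r > 0 \<and> (r / u) *\<^sub>R \<phi> \<in> B")
          case pos: True
          \<comment> \<open>Membership in \<open>B\<close> forces \<open>r \<ge> d * u > t\<close>,
            so only the tail branch of the generated density is met.\<close>
          have "d \<le> norm ((r / u) *\<^sub>R \<phi>)"
            using B(3) pos by blast
          also have "\<dots> = r / u"
            using True pos assms(1) by (simp add: cone_sphere_def)
          finally have "t < r"
            using assms(1,4) by (simp add: le_divide_eq)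
          then show ?thesis
            using pos gen_density_tail[OF p \<open>t < r\<close>] by (simp add: ennreal_mult'' mult.commute)
        qed auto
      qed
      also have "\<dots> = ?D * (\<integral>\<^sup>+r. ?h r \<partial>lborel)"
        by (rule nn_integral_cmult) measurable
      also have "(\<integral>\<^sup>+r. ?h r \<partial>lborel) = ennreal \<bar>u\<bar> * (\<integral>\<^sup>+r. ?h (0 + u * r) \<partial>lborel)"
        using assms(1) by (intro nn_integral_real_affine) measurable
      also have "(\<integral>\<^sup>+r. ?h (0 + u * r) \<partial>lborel) =
        (\<integral>\<^sup>+r. ennreal (u powr (-(s+1))) * (indicator {0<..} r * (ennreal (r powr (-(s+1))) * indicator B (r *\<^sub>R \<phi>))) \<partial>lborel)"
        using assms(1)
        by (intro nn_integral_cong)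
           (auto simp: indicator_def powr_mult ennreal_mult zero_less_mult_iff)
      also have "\<dots> = ennreal (u powr (-(s+1))) * radial_mass B \<phi>"
        unfolding radial_mass_def by (rule nn_integral_cmult) measurable
      also have "ennreal \<bar>u\<bar> * (ennreal (u powr (-(s+1))) * radial_mass B \<phi>) = ennreal (u powr (-s)) * radial_mass B \<phi>"
      proof -
        \<comment> \<open>The Jacobian \<open>u\<close> of the substitution absorbs one power of
          \<open>u\<close> from the density.\<close>
        have "\<bar>u\<bar> * u powr (-(s+1)) = u powr (-s)"
          using assms(1) by (simp add: powr_diff powr_minus field_simps powr_add)
        then show ?thesis
          by (simp flip: mult.assoc ennreal_mult)
      qed
      finally show ?thesis
        using True by (simp add: mult_ac)
    qed simp
  qed
  also have "\<dots> = ennreal (u powr (-s)) * (\<integral>\<^sup>+\<phi>. indicator (cone_sphere E) \<phi> * (ennreal (scaled_angular_density t \<phi>) * radial_mass B \<phi>) \<partial>sphere_measure)"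
    by (rule nn_integral_cmult) measurable
  finally have "ennreal (u powr s) * emeasure N {\<omega> \<in> space N. \<eta> \<omega> /\<^sub>R u \<in> B} =
      (ennreal (u powr s) * ennreal (u powr (-s))) *
      (\<integral>\<^sup>+\<phi>. indicator (cone_sphere E) \<phi> * (ennreal (scaled_angular_density t \<phi>) * radial_mass B \<phi>) \<partial>sphere_measure)"
    by (simp add: mult.assoc)
  also have "ennreal (u powr s) * ennreal (u powr (-s)) = 1"
    using assms(1) by (simp flip: ennreal_mult powr_add)
  finally show ?thesis
    by (simp add: mult.assoc)
qed

section \<open>Convergence of the scaled laws to the tail measure\<close>

text \<open>Angular weights that agree up to factors \<open>1 - e\<close> and \<open>1 + e\<close>
  give integrals that agree up to the same factors; finiteness of the limit value turns this into
  convergence.\<close>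

lemma tail_preserving_gen:
  fixes t :: "real \<Rightarrow> real" and N :: "real \<Rightarrow> 'c measure" and \<eta> :: "real \<Rightarrow> 'c \<Rightarrow> 'a"
  assumes t: "filterlim t at_top at_top" "t \<in> o[at_top](\<lambda>u. u)"
    and \<eta>: "\<And>u. u > 0 \<Longrightarrow> random_vector_in E (N u) (\<eta> u) \<and>
      has_polar_density E (N u) (\<eta> u) (gen_density M \<xi> f s (t u))"
  shows "tail_preserving E s \<phi>s N \<eta>"
proof -
  let ?\<mu> = "\<lambda>u. scale_measure (ennreal (u powr s))
              (restrict_space (distr (N u) borel (\<lambda>\<omega>. \<eta> u \<omega> /\<^sub>R u)) (E - {0}))"
  let ?\<nu> = "tail_measure E s \<phi>s"
  have \<mu>_eq: "emeasure (?\<mu> u) B = ennreal (u powr s) * emeasure (N u) {\<omega> \<in> space (N u). \<eta> u \<omega> /\<^sub>R u \<in> B}"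
    if u: "u > 0" and B: "B \<in> sets borel" "B \<subseteq> E - {0}" for u B
  proof -
    have [measurable]: "\<eta> u \<in> borel_measurable (N u)"
      using \<eta>[OF u] by (simp add: random_vector_in_def)
    have "emeasure (restrict_space (distr (N u) borel (\<lambda>\<omega>. \<eta> u \<omega> /\<^sub>R u)) (E - {0})) B
      = emeasure (distr (N u) borel (\<lambda>\<omega>. \<eta> u \<omega> /\<^sub>R u)) B"
      using sets_punctured_cone B by (intro emeasure_restrict_space) auto
    also have "\<dots> = emeasure (N u) ((\<lambda>\<omega>. \<eta> u \<omega> /\<^sub>R u) -` B \<inter> space (N u))"
      by (rule emeasure_distr) (use B in measurable)
    also have "(\<lambda>\<omega>. \<eta> u \<omega> /\<^sub>R u) -` B \<inter> space (N u) = {\<omega> \<in> space (N u). \<eta> u \<omega> /\<^sub>R u \<in> B}"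
      by auto
    finally show ?thesis by simp
  qed
  have \<mu>_M0: "?\<mu> u \<in> M0 E" if u: "u > 0" for u
  proof -
    have "sets (?\<mu> u) = sets (restrict_space borel (E - {0}))"
      by (simp add: sets_restrict_space)
    moreover have "emeasure (?\<mu> u) {z \<in> E - {0}. norm z > r} < \<infinity>" for r
    proof -
      have "emeasure (N u) A < \<infinity>" for A
        using \<eta>[OF u] by (simp add: random_vector_in_def less_top[symmetric]
            finite_measure.emeasure_finite prob_space.finite_measure)
      then show ?thesis
        unfolding \<mu>_eq[OF u sets_cone_outside Collect_restrict]
        by (auto simp: ennreal_mult_less_top)
    qed
    ultimately show ?thesis
      by (simp add: M0_def)
  qed
  have \<nu>_M0: "?\<nu> \<in> M0 E"
    using emeasure_tail_measure_finite by (simp add: M0_def tail_measure_def sets_restrict_space)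
  have conv: "((\<lambda>u. emeasure (?\<mu> u) B) \<longlongrightarrow> emeasure ?\<nu> B) at_top"
    if B': "B \<in> sets (restrict_space borel (E - {0}))" and cl: "0 \<notin> closure B" for B
  proof -
    have B: "B \<in> sets borel" "B \<subseteq> E - {0}"
      using B' sets_punctured_cone by (auto simp: sets_restrict_space_iff)
    obtain d where d: "d > 0" "\<And>z. z \<in> B \<Longrightarrow> norm z \<ge> d"
      using cl unfolding closure_approachable by (auto simp: not_less)
    \<comment> \<open>Finiteness permits a real value \<open>v\<close>, for which a small relative
      error is a small absolute one. Halving \<open>d\<close> provides the strict inequality of the
      sets in \<open>M0\<close>.\<close>
    have fin: "emeasure ?\<nu> B < \<infinity>"
    proof -
      have "B \<subseteq> {z \<in> E - {0}. norm z > d / 2}"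
        using B(2) d by force
      then have "emeasure ?\<nu> B \<le> emeasure ?\<nu> {z \<in> E - {0}. norm z > d / 2}"
      proof (rule emeasure_mono)
        show "{z \<in> E - {0}. norm z > d / 2} \<in> sets ?\<nu>"
          using sets_cone_outside[of "d / 2"] by (auto simp: tail_measure_def sets_restrict_space)
      qed
      then show ?thesis
        using emeasure_tail_measure_finite[of "d / 2"] d(1) by (auto intro: le_less_trans)
    qed
    define v where "v = enn2real (emeasure ?\<nu> B)"
    have v: "emeasure ?\<nu> B = ennreal v" "v \<ge> 0"
      using fin by (simp_all add: v_def)
    note [measurable] = B(1)
    have scaled: "(\<integral>\<^sup>+\<phi>. ennreal k * (indicator (cone_sphere E) \<phi> * ennreal (\<phi>s \<phi>) * radial_mass B \<phi>) \<partial>sphere_measure)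
        = ennreal (k * v)" if "k \<ge> 0" for k
    proof -
      have "(\<integral>\<^sup>+\<phi>. ennreal k * (indicator (cone_sphere E) \<phi> * ennreal (\<phi>s \<phi>) * radial_mass B \<phi>) \<partial>sphere_measure)
          = ennreal k * emeasure ?\<nu> B"
        unfolding emeasure_tail_measure[OF B] by (rule nn_integral_cmult) measurable
      then show ?thesis
        using v that by (simp add: ennreal_mult)
    qed
    have bounds: "\<forall>\<^sub>F u in at_top. ennreal ((1 - e) * v) \<le> emeasure (?\<mu> u) B \<and> emeasure (?\<mu> u) B \<le> ennreal ((1 + e) * v)"
      if e: "0 < e" "e < 1" for e
    proof -
      have ev: "\<forall>\<^sub>F u in at_top. P (t u)" if "\<forall>\<^sub>F t in at_top. P t" for P
        using that t(1) by (auto simp: filterlim_iff)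
      have e': "0 \<le> 1 - e" "0 \<le> 1 + e"
        using e by simp_all
      \<comment> \<open>The constant \<open>d / 2\<close> in place of \<open>d\<close> makes the
        inequality \<open>t u < d * u\<close> strict.\<close>
      have "\<forall>\<^sub>F u in at_top. norm (t u) \<le> d / 2 * norm u"
        using landau_o.smallD[OF t(2), of "d / 2"] d(1) by simp
      then show ?thesis
        using ev[OF eventually_gt_at_top[of 0]] ev[OF radial_tail_pos]
          ev[OF scaled_angular_density_bounds[OF e(1)]] eventually_gt_at_top[of 0]
      proof eventually_elim
        case (elim u)
        have "d / 2 * u < d * u"
          using elim d(1) by simp
        with elim have tu: "t u < d * u" by simp
        have meas: "\<eta> u \<in> borel_measurable (N u)"
          using \<eta> elim by (simp add: random_vector_in_def)
        have eq: "emeasure (?\<mu> u) B =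
          (\<integral>\<^sup>+\<phi>. indicator (cone_sphere E) \<phi> * ennreal (scaled_angular_density (t u) \<phi>) * radial_mass B \<phi> \<partial>sphere_measure)"
          unfolding \<mu>_eq[OF elim(5) B]
          by (rule emeasure_scaled_gen[OF elim(5) d(1) _ tu]) (use elim d tu meas \<eta> B in auto)
        have "ennreal ((1 - e) * v) \<le> emeasure (?\<mu> u) B"
          unfolding eq scaled[OF e'(1), symmetric]
        proof (rule nn_integral_mono)
          fix \<phi> :: 'a
          have "ennreal (1 - e) * ennreal (\<phi>s \<phi>) \<le> ennreal (scaled_angular_density (t u) \<phi>)" if "\<phi> \<in> cone_sphere E"
            unfolding ennreal_mult[OF e'(1) less_imp_le[OF limit_density_pos[OF that]], symmetric]
            using elim(4) that by (intro ennreal_leI) auto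
          from mult_right_mono[OF this, of "radial_mass B \<phi>"]
          show "ennreal (1 - e) * (indicator (cone_sphere E) \<phi> * ennreal (\<phi>s \<phi>) * radial_mass B \<phi>)
            \<le> indicator (cone_sphere E) \<phi> * ennreal (scaled_angular_density (t u) \<phi>) * radial_mass B \<phi>"
            by (auto simp: indicator_def mult.assoc)
        qed
        moreover have "emeasure (?\<mu> u) B \<le> ennreal ((1 + e) * v)"
          unfolding eq scaled[OF e'(2), symmetric]
        proof (rule nn_integral_mono)
          fix \<phi> :: 'a
          have "ennreal (scaled_angular_density (t u) \<phi>) \<le> ennreal (1 + e) * ennreal (\<phi>s \<phi>)" if "\<phi> \<in> cone_sphere E"
            unfolding ennreal_mult[OF e'(2) less_imp_le[OF limit_density_pos[OF that]], symmetric]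
            using elim(4) that by (intro ennreal_leI) auto
          from mult_right_mono[OF this, of "radial_mass B \<phi>"]
          show "indicator (cone_sphere E) \<phi> * ennreal (scaled_angular_density (t u) \<phi>) * radial_mass B \<phi>
            \<le> ennreal (1 + e) * (indicator (cone_sphere E) \<phi> * ennreal (\<phi>s \<phi>) * radial_mass B \<phi>)"
            by (auto simp: indicator_def mult.assoc)
        qed
        ultimately show ?case by blast
      qed
    qed
    \<comment> \<open>The witness is \<open>k / (k + v + 1)\<close>; the added 1 keeps it below 1
      even for \<open>v = 0\<close>, and \<open>e < 1\<close> keeps the factor \<open>1 - e\<close>
      nonnegative.\<close>
    have approx: "\<exists>e>0. e < 1 \<and> e * v < k" if "k > 0" for k :: real
    proof (intro exI conjI)
      have "v / (k + v + 1) < 1"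
        using that v(2) by simp
      then have "k * (v / (k + v + 1)) < k * 1"
        using that by (intro mult_strict_left_mono)
      then show "k / (k + v + 1) * v < k"
        by simp
    qed (use that v(2) in auto)
    show ?thesis
      unfolding v(1)
    proof (rule order_tendstoI)
      fix a assume a: "a < ennreal v"
      then obtain x where x: "a = ennreal x" "x \<ge> 0"
        by (metis ennreal_cases order_less_imp_not_less infinity_ennreal_def not_less_iff_gr_or_eq top.not_eq_extremum ennreal_less_top)
      then have "x < v" using a by (simp add: ennreal_less_iff)
      then obtain e where e: "0 < e" "e < 1" "e * v < v - x"
        using approx[of "v - x"] by auto
      then have "a < ennreal ((1 - e) * v)"
        using x by (simp add: ennreal_less_iff algebra_simps)
      then show "\<forall>\<^sub>F u in at_top. a < emeasure (?\<mu> u) B"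
        using bounds[OF e(1,2)] by (auto elim!: eventually_mono intro: less_le_trans)
    next
      fix a assume a: "ennreal v < a"
      \<comment> \<open>Here \<open>a\<close> may be infinite, so a real number strictly between
        \<open>v\<close> and \<open>a\<close> takes its place.\<close>
      obtain x where x: "ennreal x < a" "v < x"
        using dense[OF a] v(2) by (metis ennreal_cases ennreal_less_iff infinity_ennreal_def not_top_less top_greatest)
      then obtain e where e: "0 < e" "e < 1" "e * v < x - v"
        using approx[of "x - v"] by auto
      then have "ennreal ((1 + e) * v) \<le> ennreal x"
        by (intro ennreal_leI) (simp add: algebra_simps)
      with x(1) have "ennreal ((1 + e) * v) < a" by simp
      then show "\<forall>\<^sub>F u in at_top. emeasure (?\<mu> u) B < a"
        using bounds[OF e(1,2)] by (auto elim!: eventually_mono intro: le_less_trans)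
    qed
  qed
  have "\<forall>\<^sub>F u in at_top. ?\<mu> u \<in> M0 E"
    using eventually_gt_at_top[of 0] by eventually_elim (rule \<mu>_M0)
  then show ?thesis
    unfolding tail_preserving_def tendsto_M0_def using \<nu>_M0 \<eta> conv by blast
qed

end

theorem theorem1:
  fixes M :: "'b measure" and \<xi> :: "'b \<Rightarrow> 'a::euclidean_space"
    and E :: "'a set" and f :: "'a \<Rightarrow> real" and s :: real and \<phi>s :: "'a \<Rightarrow> real"
  assumes "closed E" and "cone E"
    and "prob_space M"
    and "\<And>z. f z \<ge> 0"
    and "distributed M lborel \<xi> (\<lambda>z. ennreal (f z))"
    and "\<And>z. z \<notin> E \<Longrightarrow> f z = 0"
    and "density_regularly_varying E f s \<phi>s"
  shows
    "((\<lambda>t. SUP (r, \<phi>)\<in>{t<..} \<times> cone_sphere E.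
         ereal \<bar>polar_density f r \<phi> / gen_density M \<xi> f s t r \<phi> - 1\<bar>) \<longlongrightarrow> 0) at_top
     \<and> (\<forall>(t :: real \<Rightarrow> real) (N :: real \<Rightarrow> 'c measure) (\<eta> :: real \<Rightarrow> 'c \<Rightarrow> 'a).
          filterlim t at_top at_top \<longrightarrow>
          t \<in> o[at_top](\<lambda>u. u) \<longrightarrow>
          (\<forall>u>0. random_vector_in E (N u) (\<eta> u) \<and>
                 has_polar_density E (N u) (\<eta> u) (gen_density M \<xi> f s (t u))) \<longrightarrow>
          tail_preserving E s \<phi>s N \<eta>)
     \<and> (\<forall>(\<theta> :: real) (N :: real \<Rightarrow> 'c measure) (\<eta> :: real \<Rightarrow> 'c \<Rightarrow> 'a).
          0 < \<theta> \<and> \<theta> < 1 \<longrightarrow>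
          (\<forall>u>0. random_vector_in E (N u) (\<eta> u) \<and>
                 has_polar_density E (N u) (\<eta> u) (gen_density M \<xi> f s (u powr \<theta>))) \<longrightarrow>
          tail_preserving E s \<phi>s N \<eta>)"
proof (intro conjI allI impI)
  show "((\<lambda>t. SUP (r, \<phi>)\<in>{t<..} \<times> cone_sphere E.
         ereal \<bar>polar_density f r \<phi> / gen_density M \<xi> f s t r \<phi> - 1\<bar>) \<longlongrightarrow> 0) at_top"
    by (rule density_ratio_uniform[OF assms])
next
  fix t :: "real \<Rightarrow> real" and N :: "real \<Rightarrow> 'c measure" and \<eta> :: "real \<Rightarrow> 'c \<Rightarrow> 'a"
  assume "filterlim t at_top at_top" "t \<in> o[at_top](\<lambda>u. u)"
    and "\<forall>u>0. random_vector_in E (N u) (\<eta> u) \<and>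
                 has_polar_density E (N u) (\<eta> u) (gen_density M \<xi> f s (t u))"
  then show "tail_preserving E s \<phi>s N \<eta>"
    by (intro tail_preserving_gen[OF assms]) auto
next
  fix \<theta> :: real and N :: "real \<Rightarrow> 'c measure" and \<eta> :: "real \<Rightarrow> 'c \<Rightarrow> 'a"
  assume \<theta>: "0 < \<theta> \<and> \<theta> < 1"
    and \<eta>: "\<forall>u>0. random_vector_in E (N u) (\<eta> u) \<and>
                 has_polar_density E (N u) (\<eta> u) (gen_density M \<xi> f s (u powr \<theta>))"
  \<comment> \<open>Divergence comes from \<open>0 < \<theta>\<close>, growth slower than
    \<open>u\<close> from \<open>\<theta> < 1\<close>.\<close>
  have "filterlim (\<lambda>u. u powr \<theta>) at_top at_top"
    using \<theta> by real_asymp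
  moreover have "(\<lambda>u. u powr \<theta>) \<in> o[at_top](\<lambda>u. u :: real)"
    using \<theta> by real_asymp
  ultimately show "tail_preserving E s \<phi>s N \<eta>"
    using \<eta> by (intro tail_preserving_gen[OF assms]) auto
qed

end
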